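(* Let $d\geq1$ and let $\mathbb{P}$ be a probability measure on $\Omega=\{-,+\}^{\mathbb{Z}^d}$ with coupling matrix $D^\sigma=(D^\sigma_{x,y})_{x,y\in\mathbb{Z}^d}$, $\sigma\in\Omega$. Assume that $\overline{D}_{x,y}:=\sup_{\sigma}D^\sigma_{x,y}$ defines a bounded operator in $\ell^2(\mathbb{Z}^d)$, with operator norm $\|\overline{D}\|_{\ell^2(\mathbb{Z}^d)}$. Then for all local functions $g:\Omega\to\mathbb{R}$ and all $t>0$, $$\mathbb{P}\left\{|g-\mathbb{E}g|\geq t\right\}\leq2\exp\left(-\frac{2t^2}{\|\overline{D}\|^2_{\ell^2(\mathbb{Z}^d)}\,\|\delta g\|^2_{\ell^2(\mathbb{Z}^d)}}\right).$$
   Context: A function $g:\Omega\to\mathbb{R}$ is local if it depends only on the coordinates in some finite $\Lambda\subset\mathbb{Z}^d$. For $\sigma\in\Omega$, $\sigma^x$ is the configuration obtained by flipping the spin at $x$; $\delta_xg=\sup_\sigma|g(\sigma^x)-g(\sigma)|$, $\delta g=(\delta_xg)_{x\in\mathbb{Z}^d}$ and $\|\delta g\|^2_{\ell^2(\mathbb{Z}^d)}=\sum_{x}(\delta_xg)^2$. If $\delta g=0$ the exponential is read as $0$. Ordering: $\Gamma:\mathbb{Z}^d\to\mathbb{N}$ is a fixed bijection, the "spiraling enumeration" of $\mathbb{Z}^d$ (the origin comes first, then the sites of the successive shells around the origin are enumerated in a spiral). Write $y\le x$ if $\Gamma(y)\leq\Gamma(x)$, $(\leq x)=\{y:\Gamma(y)\leq\Gamma(x)\}$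 and $(<x)=\{y:\Gamma(y)<\Gamma(x)\}$. Coupling matrix: for $\sigma\in\Omega$ and $x\in\mathbb{Z}^d$ let $\mathbb{P}(\cdot\mid\sigma_{<x},+_x)$ and $\mathbb{P}(\cdot\mid\sigma_{<x},-_x)$ be (fixed versions of) the conditional measures given that the configuration equals $\sigma$ on $(<x)$ and equals $+$, respectively $-$, at $x$, regarded as measures on $\Omega$. Let $\hat{\mathbb{P}}^\sigma_{x,+,-}$ be their maximal coupling, i.e. a (fixed choice of) joint law of a pair $(X_1,X_2)$ with these marginals for which the probability that $X_1$ and $X_2$ coincide off $(\le x)$ is as large as possible. Then $D^\sigma_{x,y}:=\hat{\mathbb{P}}^\sigma_{x,+,-}\{X_1(y)\neq X_2(y)\}$ (so $D^\sigma_{x,x}=1$ and $D^\sigma_{x,y}=0$ for $y\in(<x)$). *)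

theory Defs
  imports "HOL-Probability.Probability"
begin

text \<open>The lattice of dimension \<open>d = CARD('d) \<ge> 1\<close> is \<open>int ^ 'd\<close>. The spin \<open>+\<close> is \<open>True\<close> and the
  spin \<open>-\<close> is \<open>False\<close>.\<close>

type_synonym 'd config = "int ^ 'd \<Rightarrow> bool"

definition config_space :: "'d::finite config measure" where
  "config_space = (\<Pi>\<^sub>M x\<in>UNIV. count_space UNIV)"

definition flip :: "'d::finite config \<Rightarrow> int ^ 'd \<Rightarrow> 'd config" where
  "flip \<sigma> x = \<sigma>(x := \<not> \<sigma> x)"

definition local_function :: "('d::finite config \<Rightarrow> real) \<Rightarrow> bool" where
  "local_function g \<longleftrightarrow>
     (\<exists>\<Lambda>. finite \<Lambda> \<and> (\<forall>\<sigma> \<tau>. (\<forall>x\<in>\<Lambda>. \<sigma> x = \<tau> x) \<longrightarrow> g \<sigma> = g \<tau>))"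

text \<open>The real supremum is meaningful because a local function takes only finitely many values.\<close>

definition oscillation :: "('d::finite config \<Rightarrow> real) \<Rightarrow> int ^ 'd \<Rightarrow> real" where
  "oscillation g x = (SUP \<sigma>. \<bar>g (flip \<sigma> x) - g \<sigma>\<bar>)"

definition ell2 :: "('i \<Rightarrow> real) set" where
  "ell2 = {u. (\<lambda>x. (u x)\<^sup>2) summable_on UNIV}"

definition ell2_norm :: "('i \<Rightarrow> real) \<Rightarrow> real" where
  "ell2_norm u = sqrt (\<Sum>\<^sub>\<infinity>x. (u x)\<^sup>2)"

definition matrix_apply :: "('i \<Rightarrow> 'i \<Rightarrow> real) \<Rightarrow> ('i \<Rightarrow> real) \<Rightarrow> 'i \<Rightarrow> real" where
  "matrix_apply A u x = (\<Sum>\<^sub>\<infinity>y. A x y * u y)"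

definition bounded_on_ell2 :: "('i \<Rightarrow> 'i \<Rightarrow> real) \<Rightarrow> bool" where
  "bounded_on_ell2 A \<longleftrightarrow>
     (\<forall>u\<in>ell2. (\<forall>x. (\<lambda>y. A x y * u y) summable_on UNIV) \<and> matrix_apply A u \<in> ell2) \<and>
     (\<exists>C. \<forall>u\<in>ell2. ell2_norm (matrix_apply A u) \<le> C * ell2_norm u)"

text \<open>Same shape as \<^const>\<open>onorm\<close>; the quotient is \<open>0\<close> at \<open>u = 0\<close>.\<close>

definition ell2_opnorm :: "('i \<Rightarrow> 'i \<Rightarrow> real) \<Rightarrow> real" where
  "ell2_opnorm A = (SUP u\<in>ell2. ell2_norm (matrix_apply A u) / ell2_norm u)"

definition sup_norm :: "int ^ 'd::finite \<Rightarrow> int" where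
  "sup_norm x = Max (range (\<lambda>i. \<bar>x $ i\<bar>))"

text \<open>The shells are the spheres of the sup norm, as for the usual square spiral in dimension two;
  they are exhausted one after the other. The path followed inside a shell is left free, so that
  every concrete spiral is covered in every dimension.\<close>

definition spiraling_enumeration :: "(int ^ 'd::finite \<Rightarrow> nat) \<Rightarrow> bool" where
  "spiraling_enumeration \<Gamma> \<longleftrightarrow>
     bij \<Gamma> \<and> \<Gamma> 0 = 0 \<and> (\<forall>x y. sup_norm x < sup_norm y \<longrightarrow> \<Gamma> x < \<Gamma> y)"

text \<open>The event that the configuration is \<open>\<sigma>\<close> on \<open>(<x)\<close> and has spin \<open>s\<close> at \<open>x\<close>.\<close>

definition past_cylinder ::
    "(int ^ 'd::finite \<Rightarrow> nat) \<Rightarrow> int ^ 'd \<Rightarrow> 'd config \<Rightarrow> bool \<Rightarrow> 'd config set" where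
  "past_cylinder \<Gamma> x \<sigma> s = {\<eta>. (\<forall>y. \<Gamma> y < \<Gamma> x \<longrightarrow> \<eta> y = \<sigma> y) \<and> \<eta> x = s}"

text \<open>Since \<open>(\<le>x)\<close> is finite, a version of the conditional measure is determined on cylinders of
  positive probability, where it is the elementary conditional measure. On null cylinders it is an
  arbitrary probability measure carried by the cylinder. In both cases it depends on \<open>\<sigma>\<close> only
  through \<open>\<sigma>\<close> restricted to \<open>(<x)\<close>.\<close>

definition conditional_versions ::
    "(int ^ 'd::finite \<Rightarrow> nat) \<Rightarrow> 'd config measure \<Rightarrow>
     (int ^ 'd \<Rightarrow> 'd config \<Rightarrow> bool \<Rightarrow> 'd config measure) \<Rightarrow> bool" where
  "conditional_versions \<Gamma> P K \<longleftrightarrow>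
     (\<forall>x \<sigma> s.
        prob_space (K x \<sigma> s) \<and>
        sets (K x \<sigma> s) = sets config_space \<and>
        measure (K x \<sigma> s) (past_cylinder \<Gamma> x \<sigma> s) = 1 \<and>
        (measure P (past_cylinder \<Gamma> x \<sigma> s) > 0 \<longrightarrow>
           K x \<sigma> s = uniform_measure P (past_cylinder \<Gamma> x \<sigma> s)) \<and>
        (\<forall>\<tau>. (\<forall>y. \<Gamma> y < \<Gamma> x \<longrightarrow> \<tau> y = \<sigma> y) \<longrightarrow> K x \<tau> s = K x \<sigma> s))"

definition coupling_of ::
    "'d::finite config measure \<Rightarrow> 'd config measure \<Rightarrow> ('d config \<times> 'd config) measure \<Rightarrow> bool" where
  "coupling_of \<mu> \<nu> Q \<longleftrightarrow>
     prob_space Q \<and>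
     sets Q = sets (config_space \<Otimes>\<^sub>M config_space) \<and>
     distr Q config_space fst = \<mu> \<and>
     distr Q config_space snd = \<nu>"

definition agree_after ::
    "(int ^ 'd::finite \<Rightarrow> nat) \<Rightarrow> int ^ 'd \<Rightarrow> ('d config \<times> 'd config) set" where
  "agree_after \<Gamma> x = {(\<eta>, \<xi>). \<forall>y. \<Gamma> x < \<Gamma> y \<longrightarrow> \<eta> y = \<xi> y}"

definition maximal_coupling ::
    "(int ^ 'd::finite \<Rightarrow> nat) \<Rightarrow> int ^ 'd \<Rightarrow> 'd config measure \<Rightarrow> 'd config measure \<Rightarrow>
     ('d config \<times> 'd config) measure \<Rightarrow> bool" where
  "maximal_coupling \<Gamma> x \<mu> \<nu> Q \<longleftrightarrow>
     coupling_of \<mu> \<nu> Q \<and>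
     (\<forall>Q'. coupling_of \<mu> \<nu> Q' \<longrightarrow> measure Q' (agree_after \<Gamma> x) \<le> measure Q (agree_after \<Gamma> x))"

text \<open>In the next two definitions \<open>Q \<sigma> x\<close> is the chosen coupling of the conditional measures given
  \<open>\<sigma>\<close> on \<open>(<x)\<close> and \<open>+\<close>, respectively \<open>-\<close>, at \<open>x\<close>.\<close>

definition coupling_matrix ::
    "('d::finite config \<Rightarrow> int ^ 'd \<Rightarrow> ('d config \<times> 'd config) measure) \<Rightarrow>
     'd config \<Rightarrow> int ^ 'd \<Rightarrow> int ^ 'd \<Rightarrow> real" where
  "coupling_matrix Q \<sigma> x y = measure (Q \<sigma> x) {(\<eta>, \<xi>). \<eta> y \<noteq> \<xi> y}"

definition sup_coupling_matrix ::
    "('d::finite config \<Rightarrow> int ^ 'd \<Rightarrow> ('d config \<times> 'd config) measure) \<Rightarrow>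
     int ^ 'd \<Rightarrow> int ^ 'd \<Rightarrow> real" where
  "sup_coupling_matrix Q x y = (SUP \<sigma>. coupling_matrix Q \<sigma> x y)"

end

theory Submission
  imports Defs "HOL-Probability.Hoeffding"
begin

text \<open>The martingale is followed along the tree of cylinders of the enumeration, from the leaves to
  the root, so that only the elementary conditional expectations on cylinders of positive
  probability occur. Splitting a cylinder according to the spin at its next site \<open>x\<close> costs, by the
  two-point case of Hoeffding's lemma, a factor \<open>exp (l\<^sup>2 * c\<^sup>2 / 8)\<close> in the exponential moment, where
  \<open>c\<close> bounds the difference of the two conditional expectations. Integrating the discrepancy of \<open>g\<close>
  against the coupling, one can take for \<open>c\<close> the value at \<open>x\<close> of the coupling matrix applied to the
  oscillation vector. Summing the squares over \<open>x\<close> produces the operator norm, and the Chernoff bound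
  concludes.\<close>

section \<open>Two-point exponential moments and elementary conditional expectations\<close>

text \<open>Factoring out the exponential of the smaller atom leaves an inequality in the gap
  \<open>h\<close> and its weight alone, the logarithmic estimate behind Hoeffding's lemma.\<close>

lemma two_point_Hoeffding:
  fixes a b p :: real
  assumes "0 \<le> p" "p \<le> 1"
  shows "(1 - p) * exp a + p * exp b \<le> exp ((1 - p) * a + p * b + (b - a)\<^sup>2 / 8)"
proof -
  have *: "(1 - q) * exp u + q * exp v \<le> exp ((1 - q) * u + q * v + (v - u)\<^sup>2 / 8)"
    if "u \<le> v" "0 \<le> q" "q \<le> 1" for u v q :: real
  proof -
    define h where "h = v - u"
    have h: "h \<ge> 0" "v = u + h" using that by (auto simp: h_def)
    have "q * (exp h - 1) \<ge> 0" using h that by auto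
    then have pos: "1 + q * (exp h - 1) > 0" by linarith
    have "ln (1 + q * (exp h - 1)) \<le> h * q + h\<^sup>2 / 8"
      using Hoeffdings_lemma_aux[of h q] h that by simp
    then have "1 + q * (exp h - 1) \<le> exp (h * q + h\<^sup>2 / 8)"
      using pos by (metis exp_le_cancel_iff exp_ln)
    then have "exp u * (1 + q * (exp h - 1)) \<le> exp u * exp (h * q + h\<^sup>2 / 8)"
      by (intro mult_left_mono) auto
    also have "\<dots> = exp ((1 - q) * u + q * v + (v - u)\<^sup>2 / 8)"
      unfolding h(2) by (simp add: exp_add[symmetric] algebra_simps)
    also have "exp u * (1 + q * (exp h - 1)) = (1 - q) * exp u + q * exp v"
      unfolding h(2) by (simp add: exp_add algebra_simps)
    finally show ?thesis .
  qed
  show ?thesis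
  proof (cases "a \<le> b")
    case True
    then show ?thesis using * assms by blast
  next
    case False
    \<comment> \<open>Exchanging the atoms and replacing \<open>p\<close> by \<open>1 - p\<close>
      keeps the claim, since the gap enters only through its square.\<close>
    then have "(1 - (1 - p)) * exp b + (1 - p) * exp a
        \<le> exp ((1 - (1 - p)) * b + (1 - p) * a + (a - b)\<^sup>2 / 8)"
      using assms by (intro *) auto
    then show ?thesis by (simp add: add.commute power2_commute)
  qed
qed

text \<open>The normalised indicator is the density. This links the measures \<open>K\<close> to the
  quotients of set integrals that the recursion along the tree handles.\<close>

lemma (in finite_measure) integral_uniform_measure:
  fixes f :: "'a \<Rightarrow> real"
  assumes [measurable]: "f \<in> borel_measurable M" "A \<in> sets M"
  assumes "measure M A > 0"
  shows "(\<integral>x. f x \<partial>uniform_measure M A) = (LINT x:A|M. f x) / measure M A"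
proof -
  have "uniform_measure M A = density M (\<lambda>x. ennreal (indicator A x / measure M A))"
    unfolding uniform_measure_def
    using assms(3) by (intro density_cong)
      (auto simp: emeasure_eq_measure indicator_def ennreal_1[symmetric] divide_ennreal
        simp del: ennreal_1)
  then have "(\<integral>x. f x \<partial>uniform_measure M A) = (\<integral>x. (indicator A x / measure M A) *\<^sub>R f x \<partial>M)"
    by (simp add: integral_density)
  also have "\<dots> = (\<integral>x. (indicator A x *\<^sub>R f x) / measure M A \<partial>M)"
    by (intro Bochner_Integration.integral_cong) auto
  finally show ?thesis by (simp add: set_lebesgue_integral_def)
qed


subsection \<open>Local functions\<close>

lemma space_config_space [simp]: "space config_space = UNIV"
  by (simp add: config_space_def space_PiM PiE_def)

lemma spin_measurable [measurable]: "(\<lambda>\<eta>. \<eta> x) \<in> config_space \<rightarrow>\<^sub>M count_space UNIV"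
  by (simp add: config_space_def)

text \<open>Names the support, which \<open>local_function\<close> hides behind an existential; it
  indexes the finite sums and fixes the depth of the tree.\<close>

definition depends_only_on :: "('d::finite config \<Rightarrow> 'a) \<Rightarrow> (int ^ 'd) set \<Rightarrow> bool" where
  "depends_only_on g \<Lambda> \<longleftrightarrow> (\<forall>\<sigma> \<tau>. (\<forall>x\<in>\<Lambda>. \<sigma> x = \<tau> x) \<longrightarrow> g \<sigma> = g \<tau>)"

lemma depends_only_onD:
  "depends_only_on g \<Lambda> \<Longrightarrow> (\<And>x. x \<in> \<Lambda> \<Longrightarrow> \<sigma> x = \<tau> x) \<Longrightarrow> g \<sigma> = g \<tau>"
  by (auto simp: depends_only_on_def)

lemma local_function_iff: "local_function g \<longleftrightarrow> (\<exists>\<Lambda>. finite \<Lambda> \<and> depends_only_on g \<Lambda>)"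
  by (simp add: local_function_def depends_only_on_def)

lemma local_function_comp: "local_function g \<Longrightarrow> local_function (\<lambda>\<eta>. f (g \<eta>))"
  unfolding local_function_def by metis

lemma finite_range_local_function:
  assumes "local_function g"
  shows "finite (range g)"
proof -
  obtain \<Lambda> where \<Lambda>: "finite \<Lambda>" "depends_only_on g \<Lambda>"
    using assms unfolding local_function_iff by blast
  \<comment> \<open>Setting all spins off \<open>\<Lambda>\<close> to \<open>False\<close> leaves
    one representative for each subset of \<open>\<Lambda>\<close>.\<close>
  have "g \<sigma> = g (\<lambda>x. x \<in> {x \<in> \<Lambda>. \<sigma> x})" for \<sigma>
    by (rule depends_only_onD[OF \<Lambda>(2)]) auto
  then have "range g \<subseteq> (\<lambda>S. g (\<lambda>x. x \<in> S)) ` Pow \<Lambda>"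
    by (auto intro!: rev_image_eqI[where x="{x \<in> \<Lambda>. _ x}"])
  then show ?thesis using \<Lambda>(1) by (meson finite_Pow_iff finite_imageI finite_subset)
qed

text \<open>The function factors through the restriction to \<open>\<Lambda>\<close>, and a finite
  product of two-point discrete spaces is discrete, so every function on it is measurable.\<close>

lemma borel_measurable_local_function:
  fixes g :: "'d::finite config \<Rightarrow> real"
  assumes "local_function g"
  shows "g \<in> borel_measurable config_space"
proof -
  obtain \<Lambda> where \<Lambda>: "finite \<Lambda>" "depends_only_on g \<Lambda>"
    using assms unfolding local_function_iff by blast
  have "(\<lambda>\<eta>. restrict \<eta> \<Lambda>) \<in> config_space \<rightarrow>\<^sub>M (\<Pi>\<^sub>M x\<in>\<Lambda>. count_space UNIV)"
    unfolding config_space_def by (rule measurable_restrict_subset) simp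
  then have [measurable]: "(\<lambda>\<eta>. restrict \<eta> \<Lambda>) \<in> config_space \<rightarrow>\<^sub>M count_space (\<Pi>\<^sub>E x\<in>\<Lambda>. UNIV)"
    by (simp add: count_space_PiM_finite[OF \<Lambda>(1)])
  have [measurable]: "g \<in> borel_measurable (count_space (\<Pi>\<^sub>E x\<in>\<Lambda>. UNIV))" by simp
  have "(\<lambda>\<eta>. g (restrict \<eta> \<Lambda>)) \<in> borel_measurable config_space" by measurable
  also have "(\<lambda>\<eta>. g (restrict \<eta> \<Lambda>)) = g" by (intro ext depends_only_onD[OF \<Lambda>(2)]) auto
  finally show ?thesis .
qed

lemma integrable_local_function:
  fixes g :: "'d::finite config \<Rightarrow> real"
  assumes "local_function g" "finite_measure M" "sets M = sets config_space"
  shows "integrable M g"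
proof -
  interpret finite_measure M by fact
  have [measurable_cong]: "sets M = sets config_space" by fact
  obtain B where "\<And>\<eta>. norm (g \<eta>) \<le> B"
    using finite_imp_bounded[OF finite_range_local_function[OF assms(1)]]
    unfolding bounded_iff by auto
  moreover have "g \<in> borel_measurable M"
    using borel_measurable_local_function[OF assms(1)] by measurable
  ultimately show ?thesis by (intro integrable_const_bound[of _ B]) auto
qed

lemma bdd_above_oscillation:
  assumes "local_function g"
  shows "bdd_above (range (\<lambda>\<sigma>. \<bar>g (flip \<sigma> x) - g \<sigma>\<bar>))"
proof (rule bdd_above_finite)
  have "range (\<lambda>\<sigma>. \<bar>g (flip \<sigma> x) - g \<sigma>\<bar>)
      \<subseteq> (\<lambda>(a, b). \<bar>a - b\<bar>) ` (range g \<times> range g)" by auto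
  then show "finite (range (\<lambda>\<sigma>. \<bar>g (flip \<sigma> x) - g \<sigma>\<bar>))"
    using finite_range_local_function[OF assms] by (meson finite_SigmaI finite_imageI finite_subset)
qed

lemma abs_flip_le_oscillation:
  "local_function g \<Longrightarrow> \<bar>g (flip \<sigma> x) - g \<sigma>\<bar> \<le> oscillation g x"
  unfolding oscillation_def by (rule cSUP_upper[OF _ bdd_above_oscillation]) auto

lemma oscillation_nonneg: "local_function g \<Longrightarrow> 0 \<le> oscillation g x"
  using abs_flip_le_oscillation[of g _ x] abs_ge_zero order_trans by blast

lemma oscillation_eq_0:
  assumes "x \<notin> \<Lambda>" "depends_only_on g \<Lambda>"
  shows "oscillation g x = 0"
proof -
  have "g (flip \<sigma> x) = g \<sigma>" for \<sigma>
    using assms(1) by (intro depends_only_onD[OF assms(2)]) (auto simp: flip_def)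
  then show ?thesis by (simp add: oscillation_def)
qed

text \<open>Telescoping: turn \<open>\<tau>\<close> into \<open>\<sigma>\<close> one site at a time;
  only a site of disagreement costs a flip.\<close>

lemma abs_diff_le_oscillation_sum:
  assumes "local_function g" "finite \<Lambda>" "depends_only_on g \<Lambda>"
  shows "\<bar>g \<sigma> - g \<tau>\<bar> \<le> (\<Sum>x\<in>\<Lambda>. oscillation g x * of_bool (\<sigma> x \<noteq> \<tau> x))"
proof -
  have "\<bar>g (\<lambda>x. if x \<in> F then \<sigma> x else \<tau> x) - g \<tau>\<bar>
      \<le> (\<Sum>x\<in>F. oscillation g x * of_bool (\<sigma> x \<noteq> \<tau> x))" if "finite F" for F
    using that
  proof induction
    case empty
    then show ?case by simp
  next
    case (insert a F)
    let ?m = "\<lambda>F x. if x \<in> F then \<sigma> x else \<tau> x"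
    \<comment> \<open>Since \<open>a\<close> is not in \<open>F\<close>, the interpolation still
      carries the spin of \<open>\<tau>\<close> at \<open>a\<close>, so the update is either void or
      a flip.\<close>
    have "?m (insert a F) = (if \<sigma> a = \<tau> a then ?m F else flip (?m F) a)"
      using insert.hyps by (auto simp: flip_def fun_eq_iff)
    then have "\<bar>g (?m (insert a F)) - g (?m F)\<bar> \<le> oscillation g a * of_bool (\<sigma> a \<noteq> \<tau> a)"
      using abs_flip_le_oscillation[OF assms(1), of "?m F" a] by auto
    then have "\<bar>g (?m (insert a F)) - g \<tau>\<bar>
        \<le> oscillation g a * of_bool (\<sigma> a \<noteq> \<tau> a)
          + (\<Sum>x\<in>F. oscillation g x * of_bool (\<sigma> x \<noteq> \<tau> x))"
      using insert.IH by linarith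
    then show ?case unfolding sum.insert[OF insert.hyps] .
  qed
  note this[OF assms(2)]
  also have "g (\<lambda>x. if x \<in> \<Lambda> then \<sigma> x else \<tau> x) = g \<sigma>"
    by (rule depends_only_onD[OF assms(3)]) auto
  finally show ?thesis .
qed


subsection \<open>The exponential moment\<close>

text \<open>A node of depth \<open>n\<close> in the tree. Indices start at 0, so depth
  \<open>\<Gamma> x\<close> fixes exactly the sites before \<open>x\<close> and leaves
  \<open>x\<close> free.\<close>

definition cylinder :: "(int ^ 'd::finite \<Rightarrow> nat) \<Rightarrow> nat \<Rightarrow> 'd config \<Rightarrow> 'd config set" where
  "cylinder \<Gamma> n \<sigma> = {\<eta>. \<forall>y. \<Gamma> y < n \<longrightarrow> \<eta> y = \<sigma> y}"

lemma sets_cylinder: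
  assumes "inj \<Gamma>"
  shows "cylinder \<Gamma> n \<sigma> \<in> sets config_space"
proof -
  have "finite (\<Gamma> -` {..<n})" using assms by (intro finite_vimageI) auto
  then have [simp]: "finite {y. \<Gamma> y < n}" by (simp add: vimage_def)
  have "cylinder \<Gamma> n \<sigma> = {\<eta> \<in> space config_space. \<forall>y\<in>{y. \<Gamma> y < n}. \<eta> y = \<sigma> y}"
    by (auto simp: cylinder_def)
  also have "\<dots> \<in> sets config_space" by measurable
  finally show ?thesis .
qed

lemma cylinder_0 [simp]: "cylinder \<Gamma> 0 \<sigma> = UNIV"
  by (simp add: cylinder_def)

text \<open>By injectivity \<open>x\<close> is the only site that becomes fixed between depths
  \<open>\<Gamma> x\<close> and \<open>Suc (\<Gamma> x)\<close>, so the past cylinders at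
  \<open>x\<close> are the two children of a node.\<close>

lemma cylinder_Suc:
  assumes "inj \<Gamma>"
  shows "cylinder \<Gamma> (Suc (\<Gamma> x)) (\<sigma>(x := s)) = past_cylinder \<Gamma> x \<sigma> s"
  using assms by (auto simp: cylinder_def past_cylinder_def less_Suc_eq inj_eq)

lemma cylinder_split:
  "cylinder \<Gamma> (\<Gamma> x) \<sigma> = past_cylinder \<Gamma> x \<sigma> False \<union> past_cylinder \<Gamma> x \<sigma> True"
  by (auto simp: cylinder_def past_cylinder_def)

text \<open>Multiplying by \<open>w\<close> instead of dividing by it makes the bound true, with both sides zero, on
  null cylinders.\<close>

lemma weighted_exp_merge:
  fixes w0 w1 I0 I1 J0 J1 l e c :: real
  assumes J: "J0 \<le> w0 * exp (l * (I0 / w0) + e)" "J1 \<le> w1 * exp (l * (I1 / w1) + e)"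
    and w: "0 \<le> w0" "0 \<le> w1" and I: "w0 = 0 \<Longrightarrow> I0 = 0" "w1 = 0 \<Longrightarrow> I1 = 0"
    and c: "0 < w0 \<Longrightarrow> 0 < w1 \<Longrightarrow> \<bar>I1 / w1 - I0 / w0\<bar> \<le> c"
  shows "J0 + J1 \<le> (w0 + w1) * exp (l * ((I0 + I1) / (w0 + w1)) + (l\<^sup>2 * c\<^sup>2 / 8 + e))"
proof (cases "w0 = 0 \<or> w1 = 0")
  case True
  \<comment> \<open>With a null child the sums reduce to the other child, and the added square only
    enlarges the exponent.\<close>
  have mono: "w * exp (l * m + e) \<le> w * exp (l * m + (l\<^sup>2 * c\<^sup>2 / 8 + e))" if "0 \<le> w" for w m
    using that by (intro mult_left_mono) auto
  from True show ?thesis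
    using I J w mono[of w0 "I0 / w0"] mono[of w1 "I1 / w1"] by auto
next
  case False
  \<comment> \<open>\<open>p\<close> is the conditional probability of the second child given the
    parent; \<open>m0\<close> and \<open>m1\<close> are the conditional means on the
    children.\<close>
  define W p m0 m1 where "W = w0 + w1" and "p = w1 / W" and "m0 = I0 / w0" and "m1 = I1 / w1"
  have pos: "w0 > 0" "w1 > 0" "W > 0" using False w by (auto simp: W_def)
  have wp: "w0 = W * (1 - p)" "w1 = W * p" using pos by (auto simp: p_def W_def field_simps)
  have I': "I0 = w0 * m0" "I1 = w1 * m1" using pos by (auto simp: m0_def m1_def)
  have p: "0 \<le> p" "p \<le> 1" using pos by (auto simp: p_def W_def)
  have "(m1 - m0)\<^sup>2 \<le> c\<^sup>2"
    using c pos by (metis m0_def m1_def abs_ge_zero power2_abs power_mono)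
  then have sq: "(l * m1 - l * m0)\<^sup>2 \<le> l\<^sup>2 * c\<^sup>2"
    by (metis mult_left_mono power_mult_distrib right_diff_distrib zero_le_power2)
  have "(I0 + I1) / W = (1 - p) * m0 + p * m1"
    unfolding I' wp using pos by (simp add: field_simps)
  then have mean: "l * ((I0 + I1) / W) = (1 - p) * (l * m0) + p * (l * m1)"
    by (simp only: distrib_left mult.left_commute)
  have "J0 + J1 \<le> w0 * exp (l * m0 + e) + w1 * exp (l * m1 + e)"
    using J by (simp add: m0_def m1_def)
  also have "\<dots> = W * exp e * ((1 - p) * exp (l * m0) + p * exp (l * m1))"
    unfolding wp by (simp add: exp_add algebra_simps)
  also have "\<dots> \<le> W * exp e * exp ((1 - p) * (l * m0) + p * (l * m1) + (l * m1 - l * m0)\<^sup>2 / 8)"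
    using pos two_point_Hoeffding[OF p] by (intro mult_left_mono) auto
  also have "\<dots> \<le> W * exp e * exp (l * ((I0 + I1) / W) + l\<^sup>2 * c\<^sup>2 / 8)"
    unfolding mean using pos sq by (intro mult_left_mono) auto
  also have "\<dots> = W * exp (l * ((I0 + I1) / W) + (l\<^sup>2 * c\<^sup>2 / 8 + e))"
    by (simp add: exp_add)
  finally show ?thesis by (simp add: W_def)
qed

text \<open>Backward induction on the depth: each step merges two children by
  \<open>weighted_exp_merge\<close>, with \<open>e\<close> the error collected so far. As
  \<open>c x\<close> does not depend on \<open>\<sigma>\<close>, all nodes of one depth share the
  same error sum.\<close>

lemma exponential_moment_cylinder:
  fixes \<Gamma> :: "int ^ 'd::finite \<Rightarrow> nat"
  assumes "bij \<Gamma>" "prob_space P" and sets_P: "sets P = sets config_space"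
    and "local_function g" and g: "depends_only_on g {x. \<Gamma> x < N}"
    and c: "\<And>x \<sigma>. measure P (past_cylinder \<Gamma> x \<sigma> False) > 0 \<Longrightarrow>
        measure P (past_cylinder \<Gamma> x \<sigma> True) > 0 \<Longrightarrow>
        \<bar>(LINT \<eta>:past_cylinder \<Gamma> x \<sigma> True|P. g \<eta>) / measure P (past_cylinder \<Gamma> x \<sigma> True)
         - (LINT \<eta>:past_cylinder \<Gamma> x \<sigma> False|P. g \<eta>) / measure P (past_cylinder \<Gamma> x \<sigma> False)\<bar>
        \<le> c x"
    and "n \<le> N"
  shows "(LINT \<eta>:cylinder \<Gamma> n \<sigma>|P. exp (l * g \<eta>)) \<le>
      measure P (cylinder \<Gamma> n \<sigma>) *
      exp (l * ((LINT \<eta>:cylinder \<Gamma> n \<sigma>|P. g \<eta>) / measure P (cylinder \<Gamma> n \<sigma>))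
         + (\<Sum>k=n..<N. l\<^sup>2 * (c (inv \<Gamma> k))\<^sup>2 / 8))"
  using \<open>n \<le> N\<close>
proof (induction n arbitrary: \<sigma> rule: inc_induct)
  case base
  interpret prob_space P by fact
  let ?C = "cylinder \<Gamma> N \<sigma>"
  have [measurable]: "?C \<in> sets P" by (simp add: sets_P sets_cylinder bij_is_inj[OF assms(1)])
  have gC: "g \<eta> = g \<sigma>" if "\<eta> \<in> ?C" for \<eta>
    using that by (intro depends_only_onD[OF g]) (auto simp: cylinder_def)
  \<comment> \<open>\<open>g\<close> is constant on a leaf; a general \<open>f\<close> treats the
    mean and the exponential moment together.\<close>
  have int: "(LINT \<eta>:?C|P. f (g \<eta>)) = measure P ?C * f (g \<sigma>)" for f :: "real \<Rightarrow> real"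
  proof -
    have "(LINT \<eta>:?C|P. f (g \<eta>)) = (LINT \<eta>:?C|P. f (g \<sigma>))"
      by (rule set_lebesgue_integral_cong) (auto simp: gC)
    then show ?thesis by (simp add: set_lebesgue_integral_def)
  qed
  show ?case
    using int[of "\<lambda>u. u"] int[of "\<lambda>u. exp (l * u)"] by auto
next
  case (step n)
  interpret prob_space P by fact
  have inj: "inj \<Gamma>" using assms(1) by (rule bij_is_inj)
  \<comment> \<open>The first free site of the cylinder, whose spin separates the two
    children.\<close>
  define x where "x = inv \<Gamma> n"
  have n: "n = \<Gamma> x" using assms(1) by (simp add: x_def bij_is_surj surj_f_inv_f)
  define A where "A = past_cylinder \<Gamma> x \<sigma>"
  have A: "A s = cylinder \<Gamma> (Suc n) (\<sigma>(x := s))" for s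
    by (simp add: A_def n cylinder_Suc[OF inj])
  have [measurable]: "A s \<in> sets P" for s by (simp add: A sets_P sets_cylinder inj)
  have C: "cylinder \<Gamma> n \<sigma> = A False \<union> A True" by (simp add: n A_def cylinder_split)
  have disj: "A False \<inter> A True = {}" by (auto simp: A_def past_cylinder_def)
  have int: "set_integrable P (A s) f" if "local_function f" for s and f :: "'d config \<Rightarrow> real"
    unfolding set_integrable_def
    using integrable_local_function[OF that finite_measure_axioms sets_P]
    by (intro integrable_mult_indicator) auto
  have exp_local: "local_function (\<lambda>\<eta>. exp (l * g \<eta>))"
    using local_function_comp[OF assms(4), of "\<lambda>u. exp (l * u)"] .
  have null: "(LINT \<eta>:A s|P. g \<eta>) = 0" if "measure P (A s) = 0" for s
  proof -
    have "A s \<in> null_sets P" using that by (simp add: emeasure_eq_measure null_sets_def)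
    then have "AE \<eta> in P. indicator (A s) \<eta> *\<^sub>R g \<eta> = 0"
      using AE_not_in by fastforce
    then show ?thesis unfolding set_lebesgue_integral_def by (rule integral_eq_zero_AE)
  qed
  have J: "(LINT \<eta>:A s|P. exp (l * g \<eta>)) \<le> measure P (A s) *
      exp (l * ((LINT \<eta>:A s|P. g \<eta>) / measure P (A s))
        + (\<Sum>k=Suc n..<N. l\<^sup>2 * (c (inv \<Gamma> k))\<^sup>2 / 8))" for s
    unfolding A by (rule step.IH)
  have sum: "(\<Sum>k=n..<N. l\<^sup>2 * (c (inv \<Gamma> k))\<^sup>2 / 8)
      = l\<^sup>2 * (c x)\<^sup>2 / 8 + (\<Sum>k=Suc n..<N. l\<^sup>2 * (c (inv \<Gamma> k))\<^sup>2 / 8)"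
    using step.hyps by (simp add: sum.atLeast_Suc_lessThan x_def)
  have Un: "(LINT \<eta>:cylinder \<Gamma> n \<sigma>|P. f \<eta>) = (LINT \<eta>:A False|P. f \<eta>) + (LINT \<eta>:A True|P. f \<eta>)"
    if "local_function f" for f :: "'d config \<Rightarrow> real"
    unfolding C using disj int[OF that] by (rule set_integral_Un) (rule int[OF that])
  have prob_Un: "measure P (cylinder \<Gamma> n \<sigma>) = measure P (A False) + measure P (A True)"
    unfolding C using disj by (intro finite_measure_Union) auto
  have c': "\<bar>(LINT \<eta>:A True|P. g \<eta>) / measure P (A True)
      - (LINT \<eta>:A False|P. g \<eta>) / measure P (A False)\<bar> \<le> c x"
    if "0 < measure P (A False)" "0 < measure P (A True)"
    using that unfolding A_def by (rule c)
  have "(LINT \<eta>:A False|P. exp (l * g \<eta>)) + (LINT \<eta>:A True|P. exp (l * g \<eta>))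
      \<le> (measure P (A False) + measure P (A True)) *
        exp (l * (((LINT \<eta>:A False|P. g \<eta>) + (LINT \<eta>:A True|P. g \<eta>))
            / (measure P (A False) + measure P (A True)))
          + (l\<^sup>2 * (c x)\<^sup>2 / 8 + (\<Sum>k=Suc n..<N. l\<^sup>2 * (c (inv \<Gamma> k))\<^sup>2 / 8)))"
    by (rule weighted_exp_merge) (fact J null c' measure_nonneg)+
  then show ?case
    by (simp only: sum prob_Un Un[OF exp_local] Un[OF assms(4)])
qed


subsection \<open>The coupling matrix\<close>

text \<open>Measurability matters here: \<open>measure\<close> defaults to 0 outside the
  sigma-algebra, which would make an entry of the coupling matrix meaningless.\<close>

lemma disagreement_sets:
  assumes "coupling_of \<mu> \<nu> Q"
  shows "{(\<eta>, \<xi>). \<eta> y \<noteq> \<xi> y} \<in> sets Q"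
proof -
  have "{p \<in> space (config_space \<Otimes>\<^sub>M config_space). fst p y \<noteq> snd p y}
      \<in> sets (config_space \<Otimes>\<^sub>M config_space)" by measurable
  moreover have "{p \<in> space (config_space \<Otimes>\<^sub>M config_space). fst p y \<noteq> snd p y}
      = {(\<eta>, \<xi>). \<eta> y \<noteq> \<xi> y}"
    by (auto simp: space_pair_measure)
  ultimately show ?thesis using assms unfolding coupling_of_def by metis
qed

text \<open>The marginals turn the difference into one expectation under \<open>Q\<close>. The
  telescoping bound holds pointwise there, and its indicators integrate to disagreement
  probabilities.\<close>

lemma coupling_integral_diff:
  fixes g :: "'d::finite config \<Rightarrow> real"
  assumes Q: "coupling_of \<mu> \<nu> Q" and "local_function g"
    and "finite \<Lambda>" "depends_only_on g \<Lambda>"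
  shows "\<bar>(\<integral>\<eta>. g \<eta> \<partial>\<mu>) - (\<integral>\<eta>. g \<eta> \<partial>\<nu>)\<bar>
      \<le> (\<Sum>y\<in>\<Lambda>. measure Q {(\<eta>, \<xi>). \<eta> y \<noteq> \<xi> y} * oscillation g y)"
proof -
  interpret prob_space Q using Q by (simp add: coupling_of_def)
  have [measurable_cong]: "sets Q = sets (config_space \<Otimes>\<^sub>M config_space)"
    and \<mu>: "distr Q config_space fst = \<mu>" and \<nu>: "distr Q config_space snd = \<nu>"
    using Q by (auto simp: coupling_of_def)
  note [measurable] = borel_measurable_local_function[OF assms(2)]
  obtain B where B: "\<And>\<eta>. norm (g \<eta>) \<le> B"
    using finite_imp_bounded[OF finite_range_local_function[OF assms(2)]]
    unfolding bounded_iff by auto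
  have int: "integrable Q (\<lambda>p. g (fst p))" "integrable Q (\<lambda>p. g (snd p))"
    using B by (auto intro!: integrable_const_bound[of _ B])
  define E where "E y = {(\<eta> :: 'd config, \<xi> :: 'd config). \<eta> y \<noteq> \<xi> y}" for y
  have [measurable]: "E y \<in> sets Q" for y
    unfolding E_def by (rule disagreement_sets[OF Q])
  let ?D = "\<lambda>p. \<Sum>y\<in>\<Lambda>. oscillation g y * indicator (E y) p"
  have intE: "integrable Q (\<lambda>p. oscillation g y * indicator (E y) p)" for y
    by (intro integrable_mult_right integrable_real_indicator) (auto simp: emeasure_eq_measure)
  then have intD: "integrable Q ?D"
    by (intro Bochner_Integration.integrable_sum)
  have "(\<integral>\<eta>. g \<eta> \<partial>\<mu>) = (\<integral>p. g (fst p) \<partial>Q)" "(\<integral>\<eta>. g \<eta> \<partial>\<nu>) = (\<integral>p. g (snd p) \<partial>Q)"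
    unfolding \<mu>[symmetric] \<nu>[symmetric] by (subst integral_distr; simp)+
  then have "\<bar>(\<integral>\<eta>. g \<eta> \<partial>\<mu>) - (\<integral>\<eta>. g \<eta> \<partial>\<nu>)\<bar> = \<bar>\<integral>p. g (fst p) - g (snd p) \<partial>Q\<bar>"
    using int by simp
  also have "\<dots> \<le> (\<integral>p. \<bar>g (fst p) - g (snd p)\<bar> \<partial>Q)" by (rule integral_abs_bound)
  also have "\<dots> \<le> (\<integral>p. ?D p \<partial>Q)"
  proof (rule integral_mono)
    fix p
    show "\<bar>g (fst p) - g (snd p)\<bar> \<le> ?D p"
      using abs_diff_le_oscillation_sum[OF assms(2-4), of "fst p" "snd p"]
      by (simp add: E_def indicator_def case_prod_unfold of_bool_def)
  qed (use int intD in auto)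
  also have "\<dots> = (\<Sum>y\<in>\<Lambda>. measure Q (E y) * oscillation g y)"
    using intE by (simp add: mult.commute)
  finally show ?thesis unfolding E_def .
qed

text \<open>Probabilities are at most 1, so the real supremum runs over a bounded set.\<close>

lemma coupling_matrix_le_sup:
  assumes "\<And>\<sigma>. prob_space (Q \<sigma> x)"
  shows "coupling_matrix Q \<sigma> x y \<le> sup_coupling_matrix Q x y"
  unfolding sup_coupling_matrix_def coupling_matrix_def
proof (rule cSUP_upper)
  show "bdd_above (range (\<lambda>\<sigma>. measure (Q \<sigma> x) {(\<eta>, \<xi>). \<eta> y \<noteq> \<xi> y}))"
    using prob_space.prob_le_1[OF assms] by (intro bdd_aboveI[of _ 1]) auto
qed simp

section \<open>Operator norm on square-summable functions\<close>

lemma ell2_norm_matrix_apply_le: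
  assumes "bounded_on_ell2 A" "u \<in> ell2"
  shows "ell2_norm (matrix_apply A u) \<le> ell2_opnorm A * ell2_norm u"
proof -
  have nonneg: "0 \<le> ell2_norm v" for v :: "'b \<Rightarrow> real"
    by (simp add: ell2_norm_def infsum_nonneg)
  obtain C where C: "\<And>u. u \<in> ell2 \<Longrightarrow> ell2_norm (matrix_apply A u) \<le> C * ell2_norm u"
    using assms(1) by (auto simp: bounded_on_ell2_def)
  show ?thesis
  proof (cases "ell2_norm u = 0")
    \<comment> \<open>Here the quotient is 0 by division by zero and says nothing, so the constant
      \<open>C\<close> itself is used.\<close>
    case True
    then show ?thesis using C[OF assms(2)] by simp
  next
    case False
    \<comment> \<open>The absolute value keeps the bound valid where the norm of \<open>v\<close> is
      zero and the quotient is 0.\<close>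
    have "ell2_norm (matrix_apply A v) / ell2_norm v \<le> \<bar>C\<bar>" if "v \<in> ell2" for v
    proof (cases "ell2_norm v = 0")
      case False
      have "ell2_norm (matrix_apply A v) \<le> \<bar>C\<bar> * ell2_norm v"
        using C[OF that] mult_right_mono[OF abs_ge_self nonneg, of C v] by (rule order_trans)
      then show ?thesis using False nonneg[of v] by (simp add: pos_divide_le_eq)
    qed simp
    then have "ell2_norm (matrix_apply A u) / ell2_norm u \<le> ell2_opnorm A"
      unfolding ell2_opnorm_def using assms(2)
      by (intro cSUP_upper) (auto intro!: bdd_aboveI[of _ "\<bar>C\<bar>"])
    then show ?thesis using False nonneg[of u] by (simp add: field_simps)
  qed
qed

lemma sum_matrix_apply_le:
  assumes "bounded_on_ell2 A" "u \<in> ell2" "finite F"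
  shows "(\<Sum>x\<in>F. (matrix_apply A u x)\<^sup>2) \<le> (ell2_opnorm A)\<^sup>2 * (ell2_norm u)\<^sup>2"
proof -
  have s: "(\<lambda>x. (matrix_apply A u x)\<^sup>2) summable_on UNIV"
    using assms by (auto simp: bounded_on_ell2_def ell2_def)
  have "(\<Sum>x\<in>F. (matrix_apply A u x)\<^sup>2) \<le> (\<Sum>\<^sub>\<infinity>x. (matrix_apply A u x)\<^sup>2)"
    using s assms(3) by (intro finite_sum_le_infsum) auto
  also have "\<dots> = (ell2_norm (matrix_apply A u))\<^sup>2"
    by (simp add: ell2_norm_def infsum_nonneg)
  also have "\<dots> \<le> (ell2_opnorm A * ell2_norm u)\<^sup>2"
    using ell2_norm_matrix_apply_le[OF assms(1,2)]
    by (intro power_mono) (auto simp: ell2_norm_def infsum_nonneg)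
  finally show ?thesis by (simp add: power_mult_distrib)
qed

section \<open>From exponential moments to tails\<close>

text \<open>Exponential Markov inequality for both signs \<open>s\<close>; the variance term sees
  only the square of \<open>s\<close>, which is 1.\<close>

lemma (in prob_space) two_sided_Chernoff:
  fixes f :: "'a \<Rightarrow> real"
  assumes [measurable]: "f \<in> borel_measurable M" and "0 < v" "0 < t"
    and int: "\<And>l. integrable M (\<lambda>x. exp (l * f x))"
    and mgf: "\<And>l. expectation (\<lambda>x. exp (l * f x)) \<le> exp (l * m + l\<^sup>2 * v / 8)"
  shows "prob {x \<in> space M. \<bar>f x - m\<bar> \<ge> t} \<le> 2 * exp (- (2 * t\<^sup>2 / v))"
proof -
  have tail: "prob {x \<in> space M. s * (f x - m) \<ge> t} \<le> exp (- (2 * t\<^sup>2 / v))"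
    if "s = 1 \<or> s = - 1" for s :: real
  proof -
    \<comment> \<open>The minimiser of \<open>- l * t + l\<^sup>2 * v / 8\<close>, with minimum
      \<open>- (2 * t\<^sup>2 / v)\<close>.\<close>
    define l where "l = 4 * t / v"
    have l: "l > 0" using assms by (simp add: l_def)
    have s: "s\<^sup>2 = 1" using that by auto
    have eq: "exp (l * (s * (f x - m))) = exp (- (l * s * m)) * exp ((l * s) * f x)" for x
      by (simp add: exp_add[symmetric] algebra_simps)
    have i: "integrable M (\<lambda>x. exp (l * (s * (f x - m))))"
      unfolding eq using int[of "l * s"] by simp
    have "prob {x \<in> space M. s * (f x - m) \<ge> t}
        \<le> exp (- l * t) * (LINT x:space M|M. exp (l * (s * (f x - m))))"
      using i l by (intro Chernoff_ineq_ge) (auto simp: set_integrable_def cong: Bochner_Integration.integrable_cong)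
    also have "(LINT x:space M|M. exp (l * (s * (f x - m))))
        = exp (- (l * s * m)) * expectation (\<lambda>x. exp ((l * s) * f x))"
      using i by (simp add: set_integral_space eq)
    also have "\<dots> \<le> exp (- (l * s * m)) * exp (l * s * m + (l * s)\<^sup>2 * v / 8)"
      by (intro mult_left_mono mgf) auto
    also have "\<dots> = exp (l\<^sup>2 * v / 8)"
      by (simp add: exp_add[symmetric] power_mult_distrib s)
    also have "exp (- l * t) * exp (l\<^sup>2 * v / 8) = exp (- (2 * t\<^sup>2 / v))"
      using \<open>0 < v\<close> unfolding exp_add[symmetric]
      by (simp add: l_def field_simps power2_eq_square)
    finally show ?thesis by (simp add: mult_left_mono)
  qed
  have "{x \<in> space M. \<bar>f x - m\<bar> \<ge> t}
      = {x \<in> space M. 1 * (f x - m) \<ge> t} \<union> {x \<in> space M. - 1 * (f x - m) \<ge> t}"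
    by auto
  also have "prob \<dots> \<le> prob {x \<in> space M. 1 * (f x - m) \<ge> t}
      + prob {x \<in> space M. - 1 * (f x - m) \<ge> t}"
    by (rule measure_Un_le) measurable
  also have "\<dots> \<le> 2 * exp (- (2 * t\<^sup>2 / v))"
    using tail[of 1] tail[of "- 1"] by linarith
  finally show ?thesis .
qed

section \<open>Martingale increments, their sum of squares, and the concentration bound\<close>

theorem theorem5:
  fixes \<Gamma> :: "int ^ 'd::finite \<Rightarrow> nat"
    and P :: "'d config measure"
    and K :: "int ^ 'd \<Rightarrow> 'd config \<Rightarrow> bool \<Rightarrow> 'd config measure"
    and Q :: "'d config \<Rightarrow> int ^ 'd \<Rightarrow> ('d config \<times> 'd config) measure"
    and g :: "'d config \<Rightarrow> real"
    and t :: real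
  assumes "spiraling_enumeration \<Gamma>"
    and "prob_space P" and "sets P = sets config_space"
    and "conditional_versions \<Gamma> P K"
    and "\<And>\<sigma> x. maximal_coupling \<Gamma> x (K x \<sigma> True) (K x \<sigma> False) (Q \<sigma> x)"
    and "bounded_on_ell2 (sup_coupling_matrix Q)"
    and "local_function g"
    and "t > 0"
  shows "measure P {\<sigma> \<in> space P. \<bar>g \<sigma> - (\<integral>\<omega>. g \<omega> \<partial>P)\<bar> \<ge> t}
      \<le> (if oscillation g = (\<lambda>_. 0) then 0
         else 2 * exp (- (2 * t\<^sup>2 /
           ((ell2_opnorm (sup_coupling_matrix Q))\<^sup>2 * (ell2_norm (oscillation g))\<^sup>2))))"
proof -
  interpret prob_space P by fact
  have [measurable_cong]: "sets P = sets config_space" by fact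
  have space_P: "space P = UNIV" using sets_eq_imp_space_eq[OF assms(3)] by simp
  have bij: "bij \<Gamma>" using assms(1) by (simp add: spiraling_enumeration_def)
  have inj: "inj \<Gamma>" using bij by (rule bij_is_inj)
  have [measurable]: "g \<in> borel_measurable P"
    using borel_measurable_local_function[OF assms(7)] by measurable
  obtain \<Lambda> where \<Lambda>: "finite \<Lambda>" "depends_only_on g \<Lambda>"
    using assms(7) unfolding local_function_iff by blast
  have osc0: "oscillation g x = 0" if "x \<notin> \<Lambda>" for x
    using oscillation_eq_0[OF that \<Lambda>(2)] .
  define D where "D = sup_coupling_matrix Q"
  define c where "c = matrix_apply D (oscillation g)"
  define V where "V = (ell2_opnorm D)\<^sup>2 * (ell2_norm (oscillation g))\<^sup>2"
  have "(\<lambda>x. (oscillation g x)\<^sup>2) summable_on UNIV \<longleftrightarrow> (\<lambda>x. (oscillation g x)\<^sup>2) summable_on \<Lambda>"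
    by (rule summable_on_cong_neutral) (auto simp: osc0)
  then have osc_ell2: "oscillation g \<in> ell2" using \<Lambda>(1) by (simp add: ell2_def)
  \<comment> \<open>The oscillation vanishes off \<open>\<Lambda>\<close>, so the matrix-vector
    product is a finite sum.\<close>
  have c_eq: "c x = (\<Sum>y\<in>\<Lambda>. D x y * oscillation g y)" for x
  proof -
    have "c x = infsum (\<lambda>y. D x y * oscillation g y) \<Lambda>"
      unfolding c_def matrix_apply_def by (rule infsum_cong_neutral) (auto simp: osc0)
    then show ?thesis using \<Lambda>(1) by simp
  qed
  \<comment> \<open>This is the increment bound required by
    \<open>exponential_moment_cylinder\<close>. Passing from the coupling matrix to its supremum
    over configurations makes it uniform in \<open>\<sigma>\<close>.\<close>
  have cond: "\<bar>(LINT \<eta>:past_cylinder \<Gamma> x \<sigma> True|P. g \<eta>) / measure P (past_cylinder \<Gamma> x \<sigma> True)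
       - (LINT \<eta>:past_cylinder \<Gamma> x \<sigma> False|P. g \<eta>) / measure P (past_cylinder \<Gamma> x \<sigma> False)\<bar> \<le> c x"
    if "measure P (past_cylinder \<Gamma> x \<sigma> False) > 0" "measure P (past_cylinder \<Gamma> x \<sigma> True) > 0"
    for x \<sigma>
  proof -
    have K: "(\<integral>\<eta>. g \<eta> \<partial>K x \<sigma> s)
        = (LINT \<eta>:past_cylinder \<Gamma> x \<sigma> s|P. g \<eta>) / measure P (past_cylinder \<Gamma> x \<sigma> s)" for s
    proof -
      have "measure P (past_cylinder \<Gamma> x \<sigma> s) > 0" using that by (cases s) auto
      moreover from this have "K x \<sigma> s = uniform_measure P (past_cylinder \<Gamma> x \<sigma> s)"
        using assms(4) unfolding conditional_versions_def by blast
      moreover have "past_cylinder \<Gamma> x \<sigma> s \<in> sets P"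
        using sets_cylinder[OF inj] by (simp add: assms(3) cylinder_Suc[OF inj, symmetric])
      ultimately show ?thesis by (simp add: integral_uniform_measure)
    qed
    have Q: "coupling_of (K x \<tau> True) (K x \<tau> False) (Q \<tau> x)" for \<tau>
      using assms(5) by (simp add: maximal_coupling_def)
    then have "prob_space (Q \<tau> x)" for \<tau> unfolding coupling_of_def by blast
    note D_le = coupling_matrix_le_sup[of Q x, OF this, folded D_def]
    have "\<bar>(\<integral>\<eta>. g \<eta> \<partial>K x \<sigma> True) - (\<integral>\<eta>. g \<eta> \<partial>K x \<sigma> False)\<bar>
        \<le> (\<Sum>y\<in>\<Lambda>. coupling_matrix Q \<sigma> x y * oscillation g y)"
      unfolding coupling_matrix_def using coupling_integral_diff[OF Q assms(7) \<Lambda>] by blast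
    also have "\<dots> \<le> c x"
      unfolding c_eq using D_le oscillation_nonneg[OF assms(7)]
      by (intro sum_mono mult_right_mono)
    finally show ?thesis unfolding K .
  qed
  \<comment> \<open>A depth at which every site of the support has been fixed.\<close>
  obtain N where N: "\<And>x. x \<in> \<Lambda> \<Longrightarrow> \<Gamma> x < N"
    using \<Lambda>(1) finite_nat_set_iff_bounded[of "\<Gamma> ` \<Lambda>"] by auto
  then have g_N: "depends_only_on g {x. \<Gamma> x < N}"
    using \<Lambda>(2) unfolding depends_only_on_def by blast
  have mgf: "expectation (\<lambda>\<eta>. exp (l * g \<eta>)) \<le> exp (l * expectation g + l\<^sup>2 * V / 8)" for l
  proof -
    \<comment> \<open>The first \<open>N\<close> indices correspond to distinct sites, so this is a
      partial sum of a squared norm, bounded independently of \<open>N\<close>.\<close>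
    have "(\<Sum>k=0..<N. (c (inv \<Gamma> k))\<^sup>2) = (\<Sum>x\<in>inv \<Gamma> ` {0..<N}. (c x)\<^sup>2)"
      using bij by (subst sum.reindex) (auto intro: inj_on_subset[OF bij_is_inj[OF bij_imp_bij_inv]])
    also have "\<dots> \<le> V"
      unfolding c_def V_def using assms(6) osc_ell2 by (intro sum_matrix_apply_le) (auto simp: D_def)
    finally have "l\<^sup>2 * (\<Sum>k=0..<N. (c (inv \<Gamma> k))\<^sup>2) / 8 \<le> l\<^sup>2 * V / 8"
      by (intro divide_right_mono mult_left_mono) auto
    then have sum: "(\<Sum>k=0..<N. l\<^sup>2 * (c (inv \<Gamma> k))\<^sup>2 / 8) \<le> l\<^sup>2 * V / 8"
      by (simp add: sum_distrib_left sum_divide_distrib)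
    \<comment> \<open>At the root, depth 0, the cylinder is the whole space with mass 1, and the
      quotient is the expectation.\<close>
    have "expectation (\<lambda>\<eta>. exp (l * g \<eta>))
        \<le> exp (l * expectation g + (\<Sum>k=0..<N. l\<^sup>2 * (c (inv \<Gamma> k))\<^sup>2 / 8))"
      using exponential_moment_cylinder[OF bij assms(2,3,7) g_N cond, of 0 _ l] prob_space
      by (simp add: set_lebesgue_integral_def space_P)
    also have "\<dots> \<le> exp (l * expectation g + l\<^sup>2 * V / 8)" using sum by simp
    finally show ?thesis .
  qed
  show ?thesis
  proof (cases "oscillation g = (\<lambda>_. 0)")
    case True
    \<comment> \<open>Zero oscillation makes \<open>g\<close> constant, hence equal to its mean, and
      the event is empty because \<open>t\<close> is positive.\<close>
    have "g \<sigma> = g \<tau>" for \<sigma> \<tau>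
      using abs_diff_le_oscillation_sum[OF assms(7) \<Lambda>, of \<sigma> \<tau>] by (simp add: True)
    then have "g = (\<lambda>_. g undefined)" by auto
    then obtain a where "g = (\<lambda>_. a)" by blast
    then show ?thesis using True \<open>t > 0\<close> prob_space by simp
  next
    case False
    have "prob {\<sigma> \<in> space P. \<bar>g \<sigma> - expectation g\<bar> \<ge> t} \<le> 2 * exp (- (2 * t\<^sup>2 / V))"
    proof (cases "V = 0")
      \<comment> \<open>Division by zero gives exponent 0, so the right-hand side is 2 and exceeds
        any probability.\<close>
      case True
      then show ?thesis using prob_le_1[of "{\<sigma> \<in> space P. \<bar>g \<sigma> - expectation g\<bar> \<ge> t}"]
        by (simp del: prob_le_1)
    next
      case False
      then have "V > 0" by (simp add: V_def)
      then show ?thesis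
        using \<open>t > 0\<close> mgf integrable_local_function[OF local_function_comp[OF assms(7)]
            finite_measure_axioms assms(3)]
        by (intro two_sided_Chernoff) auto
    qed
    then show ?thesis using False by (simp add: V_def D_def)
  qed
qed

end
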